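(* For every $k\in\mathbb{N}$: $$\tau_{k+2,k}=\frac{1}{2k+1},\qquad \tau_{k+3,k}=\frac{1}{2k+1}\Big(\frac{2}{k+2}\Big)^{1/2},\qquad \tau_{k+4,k}=\frac{1}{2k+1}\,\frac{3}{k+3},$$ and consequently $\tau_{n,k}\le \frac{1}{2k+1}$ for $n\ge k+2$, $\tau_{n,k}\le \frac{1}{2k+1}\big(\frac{2}{k+2}\big)^{1/2}$ for $n\ge k+3$, and $\tau_{n,k}\le\frac{1}{2k+1}\frac{3}{k+3}$ for $n\ge k+4$.
   Context: $T_n$ denotes the Chebyshev polynomial of the first kind of degree $n$, $T_n(\cos\theta)=\cos n\theta$. For integers $n\ge k+2$, $k\ge 1$, let $\omega_{n,k}$ be the rightmost (largest) zero of $T_n^{(k+1)}$ and define $\tau_{n,k}:=|T_n^{(k)}(\omega_{n,k})|/T_n^{(k)}(1)$. *)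

theory Defs
  imports "HOL-Computational_Algebra.Polynomial" Complex_Main
begin

text \<open>Chebyshev polynomials of the first kind, via the three-term recurrence
  T_0 = 1, T_1 = x, T_(n+2) = 2 x T_(n+1) - T_n  (so that T_n(cos t) = cos(n t)).\<close>
fun cheb_T :: "nat \<Rightarrow> real poly" where
  "cheb_T 0 = 1"
| "cheb_T (Suc 0) = [:0, 1:]"
| "cheb_T (Suc (Suc n)) = [:0, 2:] * cheb_T (Suc n) - cheb_T n"

definition cheb_deriv :: "nat \<Rightarrow> nat \<Rightarrow> real poly" where
  "cheb_deriv n k = (pderiv ^^ k) (cheb_T n)"

definition omega :: "nat \<Rightarrow> nat \<Rightarrow> real" where
  "omega n k = Max {x. poly (cheb_deriv n (k + 1)) x = 0}"

definition tau :: "nat \<Rightarrow> nat \<Rightarrow> real" where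
  "tau n k = \<bar>poly (cheb_deriv n k) (omega n k)\<bar> / poly (cheb_deriv n k) 1"

end

theory Submission
  imports Defs
begin

text \<open>
  Write \<open>p\<close>, \<open>q\<close> for the \<open>k\<close>-th derivatives of \<open>T_n\<close> and \<open>T_(n+1)\<close>, and \<open>u\<close>, \<open>v\<close> for \<open>p\<close>, \<open>q\<close>
  normalised to take the value 1 at 1. The contiguous relations
  \<open>(1 - x^2) u' = A (x u - v)\<close> and \<open>(1 - x^2) v' = B (u - x v)\<close> with \<open>A = n + k\<close>, \<open>B = n + 1 - k\<close>
  show that \<open>H = (u^2 + v^2 - 2 x u v) / (1 - x^2)\<close> equals \<open>u^2\<close> at critical points of \<open>u\<close>,
  equals \<open>v^2\<close> at critical points of \<open>v\<close>, and that \<open>H'\<close> is a nonnegative multiple of \<open>u' v'\<close>.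
  Between the rightmost critical points of \<open>u\<close> and of \<open>v\<close> one has \<open>v' \<le> 0 \<le> u'\<close>, so \<open>H\<close>
  decreases there and \<open>tau n k\<close> is antitone in \<open>n\<close>. The three explicit values follow from the
  coefficient recurrence that the ultraspherical differential equation imposes.
\<close>

section \<open>Ladder relations and comparison of critical values\<close>

text \<open>For \<open>T_n\<close> and \<open>T_(n+1)\<close> these are
  \<open>T_n + x U_(n-1) = U_n\<close> and \<open>x U_n - T_(n+1) = U_(n-1)\<close> in disguise:
  \<open>c = n / (n + 1)\<close> absorbs the factors in \<open>T_n' = n U_(n-1)\<close> and
  \<open>T_(n+1)' = (n + 1) U_n\<close>. As identities between polynomials they can be
  differentiated.\<close>

locale ladder_pair =
  fixes p q :: "real poly" and A B c :: real
  assumes up: "[:0, 1:] * pderiv p + smult A p = smult c (pderiv q)"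
    and down: "smult c ([:0, 1:] * pderiv q - smult B q) = pderiv p"
    and A_pos: "A > 0" and B_pos: "B > 0" and c_pos: "c > 0"
begin

lemma up_at: "x * poly (pderiv p) x + A * poly p x = c * poly (pderiv q) x"
  using arg_cong[OF up, of "\<lambda>f. poly f x"] by simp

lemma down_at: "c * (x * poly (pderiv q) x - B * poly q x) = poly (pderiv p) x"
  using arg_cong[OF down, of "\<lambda>f. poly f x"] by simp

lemma pderiv_up_at:
  "x * poly (pderiv (pderiv p)) x + (A + 1) * poly (pderiv p) x = c * poly (pderiv (pderiv q)) x"
  using arg_cong[OF up, of "\<lambda>f. poly (pderiv f) x"]
  by (simp add: pderiv_add pderiv_smult pderiv_mult pderiv_pCons algebra_simps)

lemma pderiv_down_at:
  "c * (x * poly (pderiv (pderiv q)) x - (B - 1) * poly (pderiv q) x) = poly (pderiv (pderiv p)) x"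
  using arg_cong[OF down, of "\<lambda>f. poly (pderiv f) x"]
  by (simp add: pderiv_diff pderiv_smult pderiv_mult pderiv_pCons algebra_simps)

text \<open>Eliminating the derivatives of \<open>q\<close> leaves the ultraspherical equation. With
  \<open>A = n + k\<close> and \<open>B = n + 1 - k\<close> its coefficients are
  \<open>2 k + 1\<close> and \<open>n^2 - k^2\<close>.\<close>

lemma ode_p:
  "(1 - x\<^sup>2) * poly (pderiv (pderiv p)) x
     = (A - B + 2) * x * poly (pderiv p) x - A * (B - 1) * poly p x"
  using up_at[of x] pderiv_up_at[of x] pderiv_down_at[of x] by algebra

lemma ode_q:
  "(1 - x\<^sup>2) * poly (pderiv (pderiv q)) x
     = (A - B + 2) * x * poly (pderiv q) x - (A + 1) * B * poly q x"
proof -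
  have "c * poly (pderiv (pderiv q)) x
      = x * (c * (x * poly (pderiv (pderiv q)) x - (B - 1) * poly (pderiv q) x))
        + (A + 1) * (c * (x * poly (pderiv q) x - B * poly q x))"
    by (simp only: down_at pderiv_down_at pderiv_up_at)
  then have "c * ((1 - x\<^sup>2) * poly (pderiv (pderiv q)) x)
     = c * ((A - B + 2) * x * poly (pderiv q) x - (A + 1) * B * poly q x)"
    by (simp add: algebra_simps power2_eq_square)
  then show ?thesis using c_pos by simp
qed

lemma p'_eq: "(1 - x\<^sup>2) * poly (pderiv p) x = A * x * poly p x - c * B * poly q x"
  using up_at[of x] down_at[of x] by algebra

lemma q'_eq: "c * (1 - x\<^sup>2) * poly (pderiv q) x = A * poly p x - c * B * x * poly q x"
  using up_at[of x] down_at[of x] by algebra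

text \<open>The factor \<open>1 - x^2\<close> vanishes at 1. Hence \<open>A p\<close> and
  \<open>c B q\<close> are the same multiple of the normalised functions \<open>u\<close> and
  \<open>v\<close>, and they stand in for them below.\<close>

lemma value_at_1: "A * poly p 1 = c * B * poly q 1"
  using p'_eq[of 1] by simp

text \<open>At a zero of \<open>p'\<close> the first relation reads \<open>A p = c q'\<close>. If
  this were positive, the differential equation would give \<open>p'' < 0\<close>, and
  \<open>p'\<close> would turn negative just to the right of \<open>w\<close>.\<close>

lemma pderiv_q_nonpos:
  assumes w: "\<bar>w\<bar> < 1" and p'w: "poly (pderiv p) w = 0"
    and pos: "\<And>x. w < x \<Longrightarrow> poly (pderiv p) x > 0" and "B > 1"
  shows "poly (pderiv q) w \<le> 0"
proof (rule ccontr)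
  assume "\<not> poly (pderiv q) w \<le> 0"
  with up_at[of w] p'w c_pos have "A * poly p w > 0" by simp
  then have "(B - 1) * (A * poly p w) > 0" using \<open>B > 1\<close> by simp
  with ode_p[of w] p'w have "(1 - w\<^sup>2) * poly (pderiv (pderiv p)) w < 0"
    by (simp add: algebra_simps)
  moreover have "1 - w\<^sup>2 > 0" using w by (simp add: abs_square_less_1)
  ultimately have "poly (pderiv (pderiv p)) w < 0" by (simp add: mult_less_0_iff)
  from DERIV_neg_dec_right[OF poly_DERIV this] obtain d where
    "d > 0" "\<And>h. h > 0 \<Longrightarrow> h < d \<Longrightarrow> poly (pderiv p) (w + h) < poly (pderiv p) w" by blast
  from this(1) this(2)[of "d/2"] pos[of "w + d/2"] p'w show False by simp
qed

text \<open>Suppose \<open>q' > 0\<close> at \<open>x\<close>, and let \<open>d\<close> be the first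
  zero of \<open>q'\<close> after \<open>x\<close>. There the second relation gives
  \<open>c B q = - p' < 0\<close>, so \<open>q'' > 0\<close> by the differential equation, and
  \<open>q'\<close> is negative just before \<open>d\<close>. It then vanishes between
  \<open>x\<close> and \<open>d\<close>, against the choice of \<open>d\<close>.\<close>

lemma pderiv_q_nonpos_between:
  assumes w: "- 1 < w" and v: "v < 1"
    and pos: "\<And>x. w < x \<Longrightarrow> poly (pderiv p) x > 0"
    and q'v: "poly (pderiv q) v = 0"
    and x: "w < x" "x < v"
  shows "poly (pderiv q) x \<le> 0"
proof (rule ccontr)
  assume "\<not> poly (pderiv q) x \<le> 0"
  then have q'x: "poly (pderiv q) x > 0" by simp
  let ?Z = "{y. x \<le> y \<and> y \<le> v \<and> poly (pderiv q) y = 0}"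
  have "pderiv q \<noteq> 0" using q'x by auto
  then have fin: "finite ?Z"
    by (rule finite_subset[OF _ poly_roots_finite, rotated]) auto
  have ne: "?Z \<noteq> {}" using x q'v by auto
  define d where "d = Min ?Z"
  have "d \<in> ?Z" using Min_in[OF fin ne] by (simp add: d_def)
  then have d: "x < d" "d \<le> v" "poly (pderiv q) d = 0"
    using q'x by (auto simp: less_le)
  have least: "y \<ge> d" if "y \<in> ?Z" for y using Min_le[OF fin that] by (simp add: d_def)
  have d2: "1 - d\<^sup>2 > 0" using d x w v by (simp add: abs_square_less_1)
  have "c * B * poly q d = - poly (pderiv p) d" using down_at[of d] d by simp
  then have "c * B * poly q d < 0" using pos[of d] d x by simp
  then have "poly q d < 0" using c_pos B_pos by (simp add: mult_less_0_iff)
  then have "(A + 1) * B * poly q d < 0" using A_pos B_pos by (simp add: mult_less_0_iff)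
  then have "(1 - d\<^sup>2) * poly (pderiv (pderiv q)) d > 0" using ode_q[of d] d by simp
  then have "poly (pderiv (pderiv q)) d > 0" using d2 by (simp add: zero_less_mult_iff)
  from DERIV_pos_inc_left[OF poly_DERIV this] obtain e where e: "e > 0"
    "\<And>h. h > 0 \<Longrightarrow> h < e \<Longrightarrow> poly (pderiv q) (d - h) < poly (pderiv q) d" by blast
  define h where "h = min (e/2) ((d - x)/2)"
  have h: "h > 0" "h < e" "x < d - h" using e d by (auto simp: h_def min_def field_simps)
  have "poly (pderiv q) (d - h) < 0" using e(2)[OF h(1,2)] d by simp
  from poly_IVT_neg[OF h(3) q'x this] obtain y where
    "y > x" "y < d - h" "poly (pderiv q) y = 0" by blast
  with least[of y] d h show False by auto
qed

text \<open>This is the monotonicity of \<open>H\<close> on \<open>[w, v]\<close>, with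
  \<open>A p\<close> and \<open>c B q\<close> in the roles of \<open>u\<close> and \<open>v\<close>.
  The factor \<open>A - B + 1\<close>, which is \<open>2 k\<close> in the application, fixes the
  sign of \<open>H'\<close>.\<close>

lemma critical_value_le:
  assumes w: "- 1 < w" and v: "v < 1" and wv: "w \<le> v"
    and p'w: "poly (pderiv p) w = 0" and q'v: "poly (pderiv q) v = 0"
    and pos: "\<And>x. w < x \<Longrightarrow> poly (pderiv p) x > 0"
    and AB: "A - B + 1 \<ge> 0"
  shows "c * B * \<bar>poly q v\<bar> \<le> A * \<bar>poly p w\<bar>"
proof -
  define N where "N x = (A * poly p x)\<^sup>2 + (c * B * poly q x)\<^sup>2
      - 2 * x * (A * poly p x) * (c * B * poly q x)" for x
  define N' where "N' x = 2 * (A * poly p x) * (A * poly (pderiv p) x)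
      + 2 * (c * B * poly q x) * (c * B * poly (pderiv q) x)
      - (2 * (A * poly p x) * (c * B * poly q x)
         + 2 * x * (A * poly (pderiv p) x) * (c * B * poly q x)
         + 2 * x * (A * poly p x) * (c * B * poly (pderiv q) x))" for x
  define H where "H x = N x / (1 - x\<^sup>2)" for x
  have sq: "1 - x\<^sup>2 > 0" if "w \<le> x" "x \<le> v" for x
    using that w v by (simp add: abs_square_less_1)
  have dN: "(N has_real_derivative N' x) (at x)" for x
    unfolding N_def N'_def
    by (auto intro!: derivative_eq_intros poly_DERIV simp: power2_eq_square algebra_simps)
  \<comment> \<open>The left side is the numerator of \<open>H'\<close> in the quotient rule. Its
    factor \<open>(1 - x^2)^2\<close> cancels the denominator, leaving a multiple of
    \<open>p' q'\<close>.\<close>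
  have N': "N' x * (1 - x\<^sup>2) + N x * (2 * x) =
      2 * (A - B + 1) * c * (1 - x\<^sup>2)\<^sup>2 * (poly (pderiv p) x * poly (pderiv q) x)" for x
    using p'_eq[of x] q'_eq[of x] unfolding N_def N'_def by algebra
  have dH: "(H has_real_derivative
      2 * (A - B + 1) * c * (poly (pderiv p) x * poly (pderiv q) x)) (at x)"
    if "w \<le> x" "x \<le> v" for x
  proof -
    have "(H has_real_derivative (N' x * (1 - x\<^sup>2) - N x * (- 2 * x)) / (1 - x\<^sup>2)\<^sup>2) (at x)"
      unfolding H_def using sq[OF that]
      by (auto intro!: derivative_eq_intros dN simp: power2_eq_square)
    also have "N' x * (1 - x\<^sup>2) - N x * (- 2 * x) =
        2 * (A - B + 1) * c * (1 - x\<^sup>2)\<^sup>2 * (poly (pderiv p) x * poly (pderiv q) x)"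
      using N'[of x] by simp
    finally show ?thesis using sq[OF that] by (simp add: mult.assoc)
  qed
  have "H v \<le> H w"
  proof (rule DERIV_nonpos_imp_decreasing_open[OF wv])
    fix x assume x: "w < x" "x < v"
    have "poly (pderiv p) x * poly (pderiv q) x \<le> 0"
      using pos[OF x(1)] pderiv_q_nonpos_between[OF w v pos q'v x] by (simp add: mult_le_0_iff)
    then have "2 * (A - B + 1) * c * (poly (pderiv p) x * poly (pderiv q) x) \<le> 0"
      using AB c_pos by (intro mult_nonneg_nonpos[of "2 * (A - B + 1) * c"]) auto
    with dH[of x] x show "\<exists>y. (H has_real_derivative y) (at x) \<and> y \<le> 0" by auto
  next
    show "continuous_on {w..v} H"
      by (intro DERIV_continuous_on[OF DERIV_subset[OF dH]]) auto
  qed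
  moreover have "H w = (A * poly p w)\<^sup>2"
  proof -
    \<comment> \<open>Since \<open>p'\<close> vanishes at \<open>w\<close>, there
      \<open>c B q = w A p\<close>, which makes the quadratic form collapse. At \<open>v\<close> the
      roles are exchanged.\<close>
    have "N w = (1 - w\<^sup>2) * (A * poly p w)\<^sup>2"
      using p'_eq[of w] p'w unfolding N_def by algebra
    then show ?thesis using sq[of w] wv by (simp add: H_def)
  qed
  moreover have "H v = (c * B * poly q v)\<^sup>2"
  proof -
    have "N v = (1 - v\<^sup>2) * (c * B * poly q v)\<^sup>2"
      using q'_eq[of v] q'v unfolding N_def by algebra
    then show ?thesis using sq[of v] wv by (simp add: H_def)
  qed
  ultimately have "\<bar>c * B * poly q v\<bar> \<le> \<bar>A * poly p w\<bar>" by (simp add: abs_le_square_iff)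
  then show ?thesis using A_pos B_pos c_pos by (simp add: abs_mult)
qed

end

section \<open>Chebyshev derivatives as ladder pairs\<close>

lemma cheb_deriv_0 [simp]: "cheb_deriv n 0 = cheb_T n"
  by (simp add: cheb_deriv_def)

lemma pderiv_cheb_deriv [simp]: "pderiv (cheb_deriv n k) = cheb_deriv n (Suc k)"
  by (simp add: cheb_deriv_def)

text \<open>These are the addition formulas for \<open>sin ((n + 1) t)\<close> and
  \<open>sin (n t)\<close> with denominators cleared, proved by induction from the three-term
  recurrence and its derivative.\<close>

lemma cheb_T_ladder:
  fixes n :: nat
  assumes "n \<ge> 1"
  shows "(real n + 1) * (x * poly (pderiv (cheb_T n)) x + real n * poly (cheb_T n) x)
           = real n * poly (pderiv (cheb_T (Suc n))) x"
    and "real n * (x * poly (pderiv (cheb_T (Suc n))) x - (real n + 1) * poly (cheb_T (Suc n)) x)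
           = (real n + 1) * poly (pderiv (cheb_T n)) x"
  using assms
proof (induction n rule: nat_induct_at_least)
  case base
  { case 1 show ?case by (simp add: pderiv_pCons pderiv_diff pderiv_mult) }
  { case 2 show ?case by (simp add: pderiv_pCons pderiv_diff pderiv_mult algebra_simps) }
next
  case (Suc n)
  have T: "poly (cheb_T (Suc (Suc n))) x = 2 * x * poly (cheb_T (Suc n)) x - poly (cheb_T n) x"
    by simp
  have T': "poly (pderiv (cheb_T (Suc (Suc n)))) x = 2 * poly (cheb_T (Suc n)) x
      + 2 * x * poly (pderiv (cheb_T (Suc n))) x - poly (pderiv (cheb_T n)) x"
    by (simp add: pderiv_pCons pderiv_diff pderiv_mult pderiv_smult)
  have n: "real (Suc n) = real n + 1" "real n \<noteq> 0" "real n + 1 \<noteq> 0" using Suc.hyps by auto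
  note IH = Suc.IH
  have up: "(real n + 2) * (x * poly (pderiv (cheb_T (Suc n))) x + (real n + 1) * poly (cheb_T (Suc n)) x)
      = (real n + 1) * poly (pderiv (cheb_T (Suc (Suc n)))) x"
    using IH(2) unfolding T' by algebra
  \<comment> \<open>Eliminating \<open>T_n'\<close> from the two induction hypotheses leaves a
    common factor \<open>n\<close>, which is cancelled because \<open>n\<close> is nonzero.\<close>
  have "real n * ((1 - x\<^sup>2) * poly (pderiv (cheb_T (Suc n))) x)
      = real n * ((real n + 1) * (poly (cheb_T n) x - x * poly (cheb_T (Suc n)) x))"
    using IH by algebra
  then have mid: "(1 - x\<^sup>2) * poly (pderiv (cheb_T (Suc n))) x
      = (real n + 1) * (poly (cheb_T n) x - x * poly (cheb_T (Suc n)) x)"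
    using n by simp
  have down: "(real n + 1) * (x * poly (pderiv (cheb_T (Suc (Suc n)))) x
      - (real n + 2) * poly (cheb_T (Suc (Suc n))) x) = (real n + 2) * poly (pderiv (cheb_T (Suc n))) x"
    using up mid unfolding T by algebra
  { case 1 show ?case using up by (simp add: n(1) add.commute add.left_commute del: cheb_T.simps) }
  { case 2 show ?case using down by (simp add: n(1) add.commute add.left_commute del: cheb_T.simps) }
qed

text \<open>Each differentiation raises \<open>A\<close> by 1, lowers \<open>B\<close> by 1 and
  keeps \<open>c\<close>; the case \<open>k = 0\<close> has \<open>A = n\<close> and
  \<open>B = n + 1\<close>.\<close>

lemma cheb_ladder_pair:
  assumes "n \<ge> 1" "k \<le> n"
  shows "ladder_pair (cheb_deriv n k) (cheb_deriv (Suc n) k) (real n + real k) (real n + 1 - real k)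
           (real n / (real n + 1))"
proof -
  let ?c = "real n / (real n + 1)"
  have "[:0, 1:] * cheb_deriv n (Suc k) + smult (real n + real k) (cheb_deriv n k)
        = smult ?c (cheb_deriv (Suc n) (Suc k)) \<and>
      smult ?c ([:0, 1:] * cheb_deriv (Suc n) (Suc k)
        - smult (real n + 1 - real k) (cheb_deriv (Suc n) k)) = cheb_deriv n (Suc k)"
  proof (induction k)
    case 0
    have "real n + 1 \<noteq> 0" by linarith
    then show ?case
      using cheb_T_ladder[OF assms(1)]
      by (auto simp: poly_eq_poly_eq_iff[symmetric] fun_eq_iff field_simps
          simp flip: pderiv_cheb_deriv simp del: cheb_T.simps)
  next
    case (Suc k)
    from Suc[THEN conjunct1, THEN arg_cong[of _ _ pderiv]]
      Suc[THEN conjunct2, THEN arg_cong[of _ _ pderiv]]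
    show ?case
      by (simp add: pderiv_add pderiv_diff pderiv_smult pderiv_mult pderiv_pCons
          poly_eq_poly_eq_iff[symmetric] fun_eq_iff algebra_simps)
  qed
  then show ?thesis using assms by unfold_locales auto
qed

lemma cheb_deriv_ode:
  assumes "n \<ge> 1" "k \<le> n"
  shows "(1 - x\<^sup>2) * poly (cheb_deriv n (k + 2)) x
     = (2 * real k + 1) * x * poly (cheb_deriv n (k + 1)) x
       - ((real n)\<^sup>2 - (real k)\<^sup>2) * poly (cheb_deriv n k) x"
  using ladder_pair.ode_p[OF cheb_ladder_pair[OF assms], of x]
  by (simp add: power2_eq_square algebra_simps)

section \<open>Value at 1, degree and positivity\<close>

lemma poly_cheb_T_1: "poly (cheb_T n) 1 = 1"
  by (induction n rule: cheb_T.induct) auto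

text \<open>At 1 the second-order term of the differential equation drops out, so consecutive
  derivatives differ by the factor \<open>(n^2 - k^2) / (2 k + 1)\<close>.\<close>

lemma cheb_deriv_1_pos: "k \<le> n \<Longrightarrow> poly (cheb_deriv n k) 1 > 0"
proof (induction k)
  case 0 then show ?case by (simp add: poly_cheb_T_1)
next
  case (Suc k)
  have "(2 * real k + 1) * poly (cheb_deriv n (Suc k)) 1
      = ((real n)\<^sup>2 - (real k)\<^sup>2) * poly (cheb_deriv n k) 1"
    using cheb_deriv_ode[of n k 1] Suc.prems by simp
  also have "\<dots> > 0"
    using Suc by (intro mult_pos_pos) (auto simp: power_strict_mono)
  finally show ?case by (simp add: zero_less_mult_iff)
qed

lemma degree_cheb_T: "degree (cheb_T n) \<le> n"
proof (induction n rule: cheb_T.induct)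
  case (3 n)
  have "degree ([:0, 2:] * cheb_T (Suc n)) \<le> Suc (Suc n)"
    using degree_mult_le[of "[:0, 2::real:]" "cheb_T (Suc n)"] 3 by auto
  then show ?case using 3 by (auto intro: degree_diff_le)
qed auto

lemma degree_cheb_deriv: "degree (cheb_deriv n k) \<le> n - k"
proof (induction k)
  case 0 then show ?case using degree_cheb_T by simp
next
  case (Suc k)
  then show ?case by (simp add: degree_pderiv flip: pderiv_cheb_deriv)
qed

text \<open>Downward induction from the constant \<open>n\<close>-th derivative: each lower
  derivative is positive at 1 and nondecreasing from there on.\<close>

lemma cheb_deriv_pos: "k \<le> n \<Longrightarrow> x \<ge> 1 \<Longrightarrow> poly (cheb_deriv n k) x > 0"
proof (induction k arbitrary: x rule: inc_induct)
  case base
  have "degree (cheb_deriv n n) = 0" using degree_cheb_deriv[of n n] by simp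
  then obtain a where "cheb_deriv n n = [:a:]" by (rule degree_eq_zeroE)
  then show ?case using cheb_deriv_1_pos[of n n] by simp
next
  case (step k)
  have "poly (cheb_deriv n k) 1 \<le> poly (cheb_deriv n k) x"
    by (rule DERIV_nonneg_imp_nondecreasing[OF step.prems])
      (metis poly_DERIV pderiv_cheb_deriv step.IH less_imp_le)
  then show ?case using cheb_deriv_1_pos[of k n] step.hyps by simp
qed

lemma finite_roots_cheb_deriv: "k \<le> n \<Longrightarrow> finite {x. poly (cheb_deriv n k) x = 0}"
  using cheb_deriv_1_pos[of k n] by (intro poly_roots_finite) auto

section \<open>The rightmost critical point\<close>

text \<open>\<open>Max\<close> is meaningful only for a finite nonempty set; the given zero
  \<open>z\<close> provides nonemptiness. To the right of the largest zero the sign is the one at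
  1.\<close>

lemma omega_props:
  assumes "k + 1 \<le> n" and z: "poly (cheb_deriv n (k + 1)) z = 0"
  shows "z \<le> omega n k" "omega n k < 1" "poly (cheb_deriv n (k + 1)) (omega n k) = 0"
    "x > omega n k \<Longrightarrow> poly (cheb_deriv n (k + 1)) x > 0"
proof -
  let ?Z = "{x. poly (cheb_deriv n (k + 1)) x = 0}"
  have fin: "finite ?Z" by (rule finite_roots_cheb_deriv[OF assms(1)])
  show "z \<le> omega n k" unfolding omega_def using z fin by (intro Max_ge) auto
  have "omega n k \<in> ?Z" unfolding omega_def using z fin by (intro Max_in) auto
  then show root: "poly (cheb_deriv n (k + 1)) (omega n k) = 0" by simp
  then show "omega n k < 1" using cheb_deriv_pos[OF assms(1), of "omega n k"] by force
  assume x: "x > omega n k"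
  show "poly (cheb_deriv n (k + 1)) x > 0"
  proof (rule ccontr)
    assume "\<not> ?thesis"
    moreover have no: "poly (cheb_deriv n (k + 1)) y \<noteq> 0" if "y > omega n k" for y
      using Max_ge[OF fin, of y] that by (auto simp: omega_def)
    ultimately have neg: "poly (cheb_deriv n (k + 1)) x < 0" using x by force
    have "x < 1" using neg cheb_deriv_pos[OF assms(1), of x] by force
    from poly_IVT_pos[OF this neg] cheb_deriv_pos[OF assms(1), of 1] obtain y where
      "y > x" "poly (cheb_deriv n (k + 1)) y = 0" by auto
    with no x show False by force
  qed
qed

lemma omega_eqI:
  assumes "k + 1 \<le> n" "poly (cheb_deriv n (k + 1)) z = 0"
    and "\<And>x. poly (cheb_deriv n (k + 1)) x = 0 \<Longrightarrow> x \<le> z"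
  shows "omega n k = z"
  unfolding omega_def using assms finite_roots_cheb_deriv[OF assms(1)]
  by (intro Max_eqI) auto

text \<open>Comparison of the coefficients of \<open>x^j\<close> in the differential
  equation.\<close>

lemma coeff_cheb_deriv_rec:
  assumes "k \<le> n" "n \<ge> 1"
  shows "(real j + 2) * (real j + 1) * coeff (cheb_deriv n k) (j + 2)
    = - ((real n - real k - real j) * (real n + real k + real j) * coeff (cheb_deriv n k) j)"
proof -
  let ?y = "cheb_deriv n k"
  have "[:1, 0, -1:] * pderiv (pderiv ?y) = smult (2 * real k + 1) ([:0, 1:] * pderiv ?y)
      - smult ((real n)\<^sup>2 - (real k)\<^sup>2) ?y"
    using cheb_deriv_ode[OF assms(2,1)]
    by (auto simp: poly_eq_poly_eq_iff[symmetric] fun_eq_iff power2_eq_square algebra_simps)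
  from arg_cong[OF this, of "\<lambda>f. coeff f j"] show ?thesis
    by (auto simp: coeff_pCons coeff_pderiv power2_eq_square algebra_simps split: nat.splits
        simp del: pderiv_cheb_deriv)
qed

text \<open>Induction on \<open>n\<close> shows that a zero exists and bounds the largest one. For
  \<open>n = k + 2\<close> the polynomial is linear and vanishes at 0. In the step,
  \<open>q' \<le> 0\<close> at the old \<open>omega\<close> while \<open>q' > 0\<close> at 1, so
  \<open>q'\<close> has a zero no further left.\<close>

lemma omega_gt_minus_1:
  assumes "k + 2 \<le> n"
  shows "- 1 < omega n k \<and> poly (cheb_deriv n (k + 1)) (omega n k) = 0"
  using assms
proof (induction n rule: nat_induct_at_least)
  case base
  have "coeff (cheb_deriv (k + 2) (k + 1)) 2 = 0"
    using degree_cheb_deriv[of "k + 2" "k + 1"] by (intro coeff_eq_0) simp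
  with coeff_cheb_deriv_rec[of "k + 1" "k + 2" 0]
  have "coeff (cheb_deriv (k + 2) (k + 1)) 0 = 0" by (auto simp: numeral_2_eq_2)
  then have "poly (cheb_deriv (k + 2) (k + 1)) 0 = 0" by (simp add: poly_0_coeff_0)
  from omega_props[OF _ this] show ?case by force
next
  case (Suc n)
  let ?w = "omega n k"
  have root: "poly (cheb_deriv n (k + 1)) ?w = 0" using Suc by simp
  interpret ladder_pair "cheb_deriv n k" "cheb_deriv (Suc n) k" "real n + real k"
      "real n + 1 - real k" "real n / (real n + 1)"
    using Suc.hyps by (intro cheb_ladder_pair) auto
  have kn: "k + 1 \<le> n" "k + 1 \<le> Suc n" using Suc.hyps by auto
  note w = omega_props[OF kn(1) root]
  have nonpos: "poly (cheb_deriv (Suc n) (k + 1)) ?w \<le> 0"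
    using pderiv_q_nonpos[of ?w] Suc w root by (simp add: abs_less_iff)
  obtain z where "?w \<le> z" "poly (cheb_deriv (Suc n) (k + 1)) z = 0"
  proof (cases "poly (cheb_deriv (Suc n) (k + 1)) ?w = 0")
    case False
    from poly_IVT_pos[OF w(2), of "cheb_deriv (Suc n) (k + 1)"] False nonpos
      cheb_deriv_1_pos[OF kn(2)] obtain z where "?w < z" "poly (cheb_deriv (Suc n) (k + 1)) z = 0"
      by auto
    then show ?thesis using that[of z] by simp
  qed (use that in auto)
  with omega_props(1,3)[OF kn(2)] Suc show ?case by force
qed

section \<open>Monotonicity in the degree\<close>

text \<open>Dividing the comparison of critical values by the common number
  \<open>A p(1) = c B q(1)\<close> turns its two sides into the two values of
  \<open>tau\<close>.\<close>

lemma tau_Suc_le: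
  assumes "k + 2 \<le> n"
  shows "tau (Suc n) k \<le> tau n k"
proof -
  let ?p = "cheb_deriv n k" and ?q = "cheb_deriv (Suc n) k"
  let ?A = "real n + real k" and ?B = "real n + 1 - real k" and ?c = "real n / (real n + 1)"
  let ?w = "omega n k" and ?v = "omega (Suc n) k"
  interpret ladder_pair ?p ?q ?A ?B ?c
    using assms by (intro cheb_ladder_pair) auto
  have kn: "k + 1 \<le> n" "k + 1 \<le> Suc n" using assms by auto
  have w0: "- 1 < ?w" "poly (cheb_deriv n (k + 1)) ?w = 0"
    using omega_gt_minus_1[OF assms] by auto
  have v0: "poly (cheb_deriv (Suc n) (k + 1)) ?v = 0"
    using omega_gt_minus_1[of k "Suc n"] assms by auto
  note w = omega_props[OF kn(1) w0(2)] and v = omega_props[OF kn(2) v0]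
  have "poly (cheb_deriv (Suc n) (k + 1)) ?w \<le> 0"
    using pderiv_q_nonpos[of ?w] w w0 assms by (simp add: abs_less_iff)
  \<comment> \<open>\<open>q'\<close> is positive to the right of \<open>?v\<close>, but not at
    \<open>?w\<close>.\<close>
  then have wv: "?w \<le> ?v" using v(4)[of ?w] by force
  have le: "?c * ?B * \<bar>poly ?q ?v\<bar> \<le> ?A * \<bar>poly ?p ?w\<bar>"
    using w w0 v v0 wv by (intro critical_value_le) auto
  have pos: "poly ?p 1 > 0" "poly ?q 1 > 0" "?c * ?B > 0"
    using cheb_deriv_1_pos[of k] assms A_pos B_pos c_pos by auto
  have "tau (Suc n) k = (?c * ?B * \<bar>poly ?q ?v\<bar>) / (?c * ?B * poly ?q 1)"
    using pos(3) unfolding tau_def by (metis less_irrefl mult_divide_mult_cancel_left)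
  also have "\<dots> \<le> (?A * \<bar>poly ?p ?w\<bar>) / (?c * ?B * poly ?q 1)"
    using le mult_pos_pos[OF pos(3,2)] by (intro divide_right_mono) simp_all
  also have "\<dots> = tau n k"
    unfolding value_at_1[symmetric] tau_def using A_pos by simp
  finally show ?thesis .
qed

lemma tau_antimono:
  assumes "k + 2 \<le> m" "m \<le> n"
  shows "tau n k \<le> tau m k"
  using assms(2)
proof (induction n rule: nat_induct_at_least)
  case (Suc n)
  then show ?case using tau_Suc_le[of k n] assms(1) by simp
qed simp

section \<open>Explicit values for the three smallest degrees\<close>

lemma coeff_cheb_deriv_eq_0: "n - k < j \<Longrightarrow> coeff (cheb_deriv n k) j = 0"
  using degree_cheb_deriv[of n k] by (intro coeff_eq_0) simp

text \<open>The recurrence fixes the polynomial up to a scale \<open>e\<close>, which cancels in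
  \<open>tau\<close>. Positivity at 1 shows \<open>e > 0\<close>.\<close>

lemma tau_add_2: "tau (k + 2) k = 1 / (2 * real k + 1)"
proof -
  let ?y = "cheb_deriv (k + 2) k"
  define e where "e = - coeff ?y 0"
  note rec = coeff_cheb_deriv_rec[of k "k + 2", simplified]
  \<comment> \<open>The coefficient two places higher vanishes by degree and the recurrence factor
    is nonzero; this is how the terms of the wrong parity disappear.\<close>
  have c1: "coeff ?y 1 = 0"
    using rec[of 1] coeff_cheb_deriv_eq_0[of "k + 2" k 3] by (simp add: numeral_3_eq_3)
  have c2: "coeff ?y 2 = 2 * (real k + 1) * e"
    using rec[of 0] by (simp add: e_def algebra_simps numeral_2_eq_2)
  have y: "?y = [:- e, 0, 2 * (real k + 1) * e:]"
  proof (rule poly_eqI)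
    fix j show "coeff ?y j = coeff [:- e, 0, 2 * (real k + 1) * e:] j"
      using c1 c2 coeff_cheb_deriv_eq_0[of "k + 2" k j]
      by (auto simp: coeff_pCons numeral_eq_Suc e_def split: nat.splits)
  qed
  have y1: "poly ?y 1 = (2 * real k + 1) * e" unfolding y by (simp add: algebra_simps)
  with cheb_deriv_1_pos[of k "k + 2"] have e: "e > 0" by (simp add: zero_less_mult_iff)
  have y': "poly (cheb_deriv (k + 2) (k + 1)) x = 4 * (real k + 1) * e * x" for x
    using arg_cong[OF y, of "\<lambda>f. poly (pderiv f) x"] by (simp add: pderiv_pCons algebra_simps)
  have "omega (k + 2) k = 0"
    by (rule omega_eqI) (use e in \<open>simp_all only: y', simp_all\<close>)
  then have "tau (k + 2) k = \<bar>poly ?y 0\<bar> / poly ?y 1" by (simp add: tau_def)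
  also have "\<dots> = e / ((2 * real k + 1) * e)" unfolding y1 using e by (subst y) simp
  finally show ?thesis using e by simp
qed

lemma tau_add_3: "tau (k + 3) k = 1 / (2 * real k + 1) * sqrt (2 / (real k + 2))"
proof -
  let ?y = "cheb_deriv (k + 3) k"
  define e where "e = - coeff ?y 1 / 3"
  \<comment> \<open>The positive zero of \<open>2 (k + 2) x^2 - 1\<close>, to which the derivative
    is proportional.\<close>
  define w where "w = sqrt (1 / (2 * (real k + 2)))"
  note rec = coeff_cheb_deriv_rec[of k "k + 3", simplified]
  have c2: "coeff ?y 2 = 0"
    using rec[of 2] coeff_cheb_deriv_eq_0[of "k + 3" k 4] by simp
  have c0: "coeff ?y 0 = 0"
    using rec[of 0] c2 by (auto simp: numeral_2_eq_2)
  have c3: "coeff ?y 3 = 2 * (real k + 2) * e"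
    using rec[of 1] by (simp add: e_def field_simps numeral_3_eq_3)
  have y: "?y = [:0, - 3 * e, 0, 2 * (real k + 2) * e:]"
  proof (rule poly_eqI)
    fix j show "coeff ?y j = coeff [:0, - 3 * e, 0, 2 * (real k + 2) * e:] j"
      using c0 c2 c3 coeff_cheb_deriv_eq_0[of "k + 3" k j]
      by (auto simp: coeff_pCons numeral_eq_Suc e_def split: nat.splits)
  qed
  have y1: "poly ?y 1 = (2 * real k + 1) * e" unfolding y by (simp add: algebra_simps)
  with cheb_deriv_1_pos[of k "k + 3"] have e: "e > 0" by (simp add: zero_less_mult_iff)
  have w2: "2 * (real k + 2) * w\<^sup>2 = 1" by (simp add: w_def)
  have w0: "w > 0" by (simp add: w_def)
  have y': "poly (cheb_deriv (k + 3) (k + 1)) x = 6 * (real k + 2) * e * (x\<^sup>2 - w\<^sup>2)" for x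
  proof -
    have "poly (cheb_deriv (k + 3) (k + 1)) x = 6 * (real k + 2) * e * x\<^sup>2 - 3 * e"
      using arg_cong[OF y, of "\<lambda>f. poly (pderiv f) x"]
      by (simp add: pderiv_pCons power2_eq_square algebra_simps)
    then show ?thesis using w2 by algebra
  qed
  have "omega (k + 3) k = w"
  proof (rule omega_eqI)
    fix x assume "poly (cheb_deriv (k + 3) (k + 1)) x = 0"
    then have "x\<^sup>2 = w\<^sup>2" using e by (simp only: y') simp
    then show "x \<le> w" using w0 by (simp add: power2_eq_iff) linarith
  qed (simp_all only: y', simp_all)
  then have "tau (k + 3) k = \<bar>poly ?y w\<bar> / poly ?y 1" by (simp add: tau_def)
  also have "poly ?y w = - (2 * e * w)"
  proof -
    have "poly ?y w = - 3 * e * w + 2 * (real k + 2) * e * w ^ 3"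
      by (subst y) (simp add: power3_eq_cube algebra_simps)
    then show ?thesis using w2 by algebra
  qed
  also have "\<bar>- (2 * e * w)\<bar> / poly ?y 1 = 1 / (2 * real k + 1) * (2 * w)"
    unfolding y1 using e w0 by (simp add: abs_mult)
  also have "2 * w = sqrt (2 / (real k + 2))"
  proof (rule real_sqrt_unique[symmetric])
    show "(2 * w)\<^sup>2 = 2 / (real k + 2)" using w2 by (simp add: field_simps)
  qed (use w0 in simp)
  finally show ?thesis .
qed

lemma tau_add_4: "tau (k + 4) k = 1 / (2 * real k + 1) * (3 / (real k + 3))"
proof -
  let ?y = "cheb_deriv (k + 4) k"
  define e where "e = coeff ?y 0 / 3"
  \<comment> \<open>The derivative is proportional to \<open>x (2 (k + 3) x^2 - 3)\<close>;
    \<open>w\<close> is its largest zero.\<close>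
  define w where "w = sqrt (3 / (2 * (real k + 3)))"
  note rec = coeff_cheb_deriv_rec[of k "k + 4", simplified]
  let ?r = "[:3 * e, 0, - 12 * (real k + 2) * e, 0, 4 * (real k + 2) * (real k + 3) * e:]"
  have c3: "coeff ?y 3 = 0"
    using rec[of 3] coeff_cheb_deriv_eq_0[of "k + 4" k 5] by simp
  have c1: "coeff ?y 1 = 0"
    using rec[of 1] c3 by (auto simp: numeral_3_eq_3)
  have c2: "coeff ?y 2 = - 12 * (real k + 2) * e"
    using rec[of 0] by (simp add: e_def algebra_simps numeral_2_eq_2)
  have c4: "coeff ?y 4 = 4 * (real k + 2) * (real k + 3) * e"
    using rec[of 2] c2 by (simp add: algebra_simps)
  have y: "?y = ?r"
  proof (rule poly_eqI)
    fix j show "coeff ?y j = coeff ?r j"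
      using c1 c2 c3 c4 coeff_cheb_deriv_eq_0[of "k + 4" k j]
      by (auto simp: coeff_pCons numeral_eq_Suc e_def split: nat.splits)
  qed
  have y1: "poly ?y 1 = (2 * real k + 1) * (2 * real k + 3) * e"
    unfolding y by (simp add: algebra_simps)
  have "(2 * real k + 1) * (2 * real k + 3) > 0" by (intro mult_pos_pos) auto
  with cheb_deriv_1_pos[of k "k + 4"] y1 have e: "e > 0"
    by (metis zero_less_mult_pos le_add1)
  have w2: "2 * (real k + 3) * w\<^sup>2 = 3" by (simp add: w_def divide_simps)
  have w0: "w > 0" by (simp add: w_def)
  have y': "poly (cheb_deriv (k + 4) (k + 1)) x
      = 16 * (real k + 2) * (real k + 3) * e * (x * (x\<^sup>2 - w\<^sup>2))" for x
  proof -
    have "poly (cheb_deriv (k + 4) (k + 1)) x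
        = 16 * (real k + 2) * (real k + 3) * e * x ^ 3 - 24 * (real k + 2) * e * x"
      using arg_cong[OF y, of "\<lambda>f. poly (pderiv f) x"]
      by (simp add: pderiv_pCons power3_eq_cube algebra_simps)
    then show ?thesis using w2 by algebra
  qed
  have "omega (k + 4) k = w"
  proof (rule omega_eqI)
    fix x assume "poly (cheb_deriv (k + 4) (k + 1)) x = 0"
    then have "x = 0 \<or> x\<^sup>2 = w\<^sup>2" using e by (simp only: y') simp
    then show "x \<le> w" using w0 by (auto simp: power2_eq_iff)
  qed (simp_all only: y', simp_all)
  then have "tau (k + 4) k = \<bar>poly ?y w\<bar> / poly ?y 1" by (simp add: tau_def)
  \<comment> \<open>The factor \<open>2 k + 3\<close> cancels against the one in the value at
    1.\<close>
  also have "poly ?y w = - (3 * (2 * real k + 3) * e / (real k + 3))"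
  proof -
    have "poly ?y w = 3 * e - 12 * (real k + 2) * e * w\<^sup>2
        + 4 * (real k + 2) * (real k + 3) * e * (w\<^sup>2)\<^sup>2"
      by (subst y) (simp add: power2_eq_square algebra_simps)
    then have "(real k + 3) * poly ?y w = - (3 * (2 * real k + 3) * e)" using w2 by algebra
    then show ?thesis by (simp add: field_simps)
  qed
  also have "\<bar>- (3 * (2 * real k + 3) * e / (real k + 3))\<bar> / poly ?y 1
      = 1 / (2 * real k + 1) * (3 / (real k + 3))"
    unfolding y1 using e by (simp add: abs_mult divide_simps)
  finally show ?thesis .
qed

theorem theorem1p2:
  fixes k :: nat
  assumes "k \<ge> 1"
  shows "tau (k + 2) k = 1 / (2 * real k + 1)
    \<and> tau (k + 3) k = 1 / (2 * real k + 1) * sqrt (2 / (real k + 2))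
    \<and> tau (k + 4) k = 1 / (2 * real k + 1) * (3 / (real k + 3))
    \<and> (\<forall>n. n \<ge> k + 2 \<longrightarrow> tau n k \<le> 1 / (2 * real k + 1))
    \<and> (\<forall>n. n \<ge> k + 3 \<longrightarrow> tau n k \<le> 1 / (2 * real k + 1) * sqrt (2 / (real k + 2)))
    \<and> (\<forall>n. n \<ge> k + 4 \<longrightarrow> tau n k \<le> 1 / (2 * real k + 1) * (3 / (real k + 3)))"
  using tau_antimono[of k "k + 2"] tau_antimono[of k "k + 3"] tau_antimono[of k "k + 4"]
  unfolding tau_add_2 tau_add_3 tau_add_4 by simp

end
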